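(* In dimension $d\ge 4$, it is possible to choose $n\le\lfloor d/2\rfloor$ polytopes $P_1,\dots,P_n$ so that the trivial upper bound for the number of $k$-faces of $P_1+\cdots+P_n$ is attained for all $0\le k\le\lfloor d/2\rfloor-n$. That is, for every $d\ge 4$ and every $n$ with $1\le n\le\lfloor d/2\rfloor$ there exist $d$-dimensional polytopes $P_1,\dots,P_n$ in $\mathbb{R}^d$ such that, for every integer $k$ with $0\le k\le\lfloor d/2\rfloor-n$, $$f_k(P_1+\cdots+P_n)=\sum_{\substack{1\le s_i\le f_0(P_i)\\ s_1+\cdots+s_n=k+n}}\ \prod_{i=1}^n\binom{f_0(P_i)}{s_i},$$ where the sum is over all integer tuples $(s_1,\dots,s_n)$ satisfying the indicated conditions.
   Context: $f_k(P)$ denotes the number of $k$-dimensional faces of a convex polytope $P$ (so $f_0(P)$ is its number of vertices), and $P_1+\cdots+P_n=\{x_1+\cdots+x_n: x_i\in P_i\}$ is the Minkowski sum. For $d$-dimensional polytopes $P_1,\dots,P_n$ and $0\le k\le d-1$, the trivial upper bound for the number of $k$-faces of the Minkowski sum is that $f_k(P_1+\cdots+P_n)$ is at most the right-hand side of the displayed formula. *)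

theory Defs
  imports "HOL-Analysis.Analysis" "HOL-Library.Set_Algebras" "HOL-Library.FuncSet"
begin

definition num_faces :: "nat \<Rightarrow> 'a::euclidean_space set \<Rightarrow> nat" where
  "num_faces k P = card {F. F face_of P \<and> aff_dim F = int k}"

text \<open>
  The Minkowski sum of a finite family of sets is the sum in the commutative monoid of sets from
  \<^theory>\<open>HOL-Library.Set_Algebras\<close>; the lemma spells out its elements.
\<close>

lemma Minkowski_sum_eq:
  fixes P :: "'i \<Rightarrow> 'a::comm_monoid_add set"
  assumes "finite I"
  shows "(\<Sum>i\<in>I. P i) = {\<Sum>i\<in>I. x i |x. \<forall>i\<in>I. x i \<in> P i}"
  using set_sum_alt[OF assms, of P] by blast

definition trivial_face_bound :: "nat \<Rightarrow> nat \<Rightarrow> (nat \<Rightarrow> 'a::euclidean_space set) \<Rightarrow> nat" where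
  "trivial_face_bound n k P =
     (\<Sum>s | s \<in> (\<Pi>\<^sub>E i\<in>{1..n}. {1..num_faces 0 (P i)}) \<and> (\<Sum>i=1..n. s i) = k + n.
        \<Prod>i=1..n. num_faces 0 (P i) choose s i)"

end

theory Submission
  imports Defs "HOL-Computational_Algebra.Polynomial"
begin

text \<open>
  Place \<open>n\<close> disjoint sets of \<open>d + 1\<close> points on the moment curve and let the \<open>P i\<close> be the simplices
  they span. Any set \<open>S\<close> of at most \<open>\<lfloor>d/2\<rfloor>\<close> parameters is cut out on the whole curve by a single
  supporting functional, the one given by the polynomial \<open>\<Prod>s\<in>S. (t - s)\<^sup>2\<close>. Hence nonempty vertex
  subsets \<open>A i\<close> of the \<open>P i\<close> with \<open>k + n\<close> points in total yield a face \<open>\<Sum>i. conv (A i)\<close> of the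
  Minkowski sum, from which the \<open>A i\<close> can be recovered, and whose dimension is \<open>k\<close> since any \<open>d + 1\<close>
  points on the curve are affinely independent. Conversely every nonempty face of the sum has the form
  \<open>\<Sum>i. conv (A i)\<close>; if its dimension is \<open>k\<close>, then the \<open>A i\<close> have \<open>k + n\<close> points in total, since
  otherwise a subfamily with \<open>k + n + 1\<close> points would span dimension \<open>k + 1\<close>.
\<close>

section \<open>Faces of Minkowski sums cut out by linear functionals\<close>

lemma convex_hull_halfspace_ge:
  fixes S :: "'a::real_inner set"
  assumes "x \<in> convex hull S" and "\<And>y. y \<in> S \<Longrightarrow> b \<le> c \<bullet> y"
  shows "b \<le> c \<bullet> x"
proof -
  have "convex hull S \<subseteq> {x. b \<le> c \<bullet> x}"
    by (rule hull_minimal) (use assms(2) convex_halfspace_ge[of b c] in auto)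
  with assms(1) show ?thesis by auto
qed

text \<open>The intersection is a face, and a face of the hull of a compact set is the hull of a
  subset of that set. That subset lies in the hyperplane, which gives the nontrivial
  inclusion.\<close>

lemma convex_hull_Int_supporting_hyperplane:
  fixes S :: "'a::euclidean_space set"
  assumes "finite S" and "\<And>x. x \<in> S \<Longrightarrow> b \<le> c \<bullet> x"
  shows "convex hull S \<inter> {x. c \<bullet> x = b} = convex hull {x \<in> S. c \<bullet> x = b}"
proof
  have "(convex hull S \<inter> {x. c \<bullet> x = b}) face_of (convex hull S)"
    by (intro face_of_Int_supporting_hyperplane_ge) (use assms(2) in \<open>auto elim: convex_hull_halfspace_ge\<close>)
  then obtain S' where "S' \<subseteq> S" and S': "convex hull S \<inter> {x. c \<bullet> x = b} = convex hull S'"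
    using face_of_convex_hull_subset finite_imp_compact[OF assms(1)] by metis
  moreover have "S' \<subseteq> {x. c \<bullet> x = b}"
    using S' hull_subset[of S' convex] by blast
  ultimately have "S' \<subseteq> {x \<in> S. c \<bullet> x = b}" by auto
  then show "convex hull S \<inter> {x. c \<bullet> x = b} \<subseteq> convex hull {x \<in> S. c \<bullet> x = b}"
    unfolding S' by (rule hull_mono)
next
  have "convex hull {x \<in> S. c \<bullet> x = b} \<subseteq> {x. c \<bullet> x = b}"
    by (rule hull_minimal) (use convex_hyperplane[of c b] in auto)
  then show "convex hull {x \<in> S. c \<bullet> x = b} \<subseteq> convex hull S \<inter> {x. c \<bullet> x = b}"
    using hull_mono[of "{x \<in> S. c \<bullet> x = b}" S convex] by auto
qed

text \<open>The excesses \<open>c \<bullet> x i - b i\<close> are nonnegative, so their sum vanishes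
  only if each of them does.\<close>

lemma Minkowski_sum_Int_supporting_hyperplane:
  fixes C :: "'i \<Rightarrow> 'a::real_inner set"
  assumes "finite I" and ge: "\<And>i x. i \<in> I \<Longrightarrow> x \<in> C i \<Longrightarrow> b i \<le> c \<bullet> x"
  shows "(\<Sum>i\<in>I. C i) \<inter> {x. c \<bullet> x = sum b I} = (\<Sum>i\<in>I. C i \<inter> {x. c \<bullet> x = b i})" (is "?L = ?R")
proof
  show "?L \<subseteq> ?R"
  proof
    fix z assume "z \<in> ?L"
    then obtain x where z: "z = sum x I" and x: "\<forall>i\<in>I. x i \<in> C i" and eq: "c \<bullet> sum x I = sum b I"
      unfolding Minkowski_sum_eq[OF assms(1)] by auto
    have "(\<Sum>i\<in>I. c \<bullet> x i - b i) = 0"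
      using eq by (simp add: inner_sum_right sum_subtractf)
    then have "\<forall>i\<in>I. c \<bullet> x i - b i = 0"
      by (subst (asm) sum_nonneg_eq_0_iff) (use assms(1) ge x in auto)
    then show "z \<in> ?R"
      unfolding Minkowski_sum_eq[OF assms(1)] using z x by auto
  qed
  show "?R \<subseteq> ?L"
    unfolding Minkowski_sum_eq[OF assms(1)] by (auto simp: inner_sum_right)
qed

text \<open>Minimising a functional over the sum decouples into minimising it over each generating
  set. The numbers \<open>b i\<close> are only required to be lower bounds, so the face obtained may
  be empty.\<close>

lemma exposed_Minkowski_sum_convex_hull:
  fixes V :: "'i \<Rightarrow> 'a::euclidean_space set"
  assumes "finite I" and "\<And>i. i \<in> I \<Longrightarrow> finite (V i)"
    and "\<And>i x. i \<in> I \<Longrightarrow> x \<in> V i \<Longrightarrow> b i \<le> c \<bullet> x"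
  shows "\<And>z. z \<in> (\<Sum>i\<in>I. convex hull V i) \<Longrightarrow> sum b I \<le> c \<bullet> z"
    and "(\<Sum>i\<in>I. convex hull V i) \<inter> {x. c \<bullet> x = sum b I} =
         (\<Sum>i\<in>I. convex hull {x \<in> V i. c \<bullet> x = b i})"
    and "(\<Sum>i\<in>I. convex hull {x \<in> V i. c \<bullet> x = b i}) face_of (\<Sum>i\<in>I. convex hull V i)"
proof -
  have ge: "b i \<le> c \<bullet> x" if "i \<in> I" "x \<in> convex hull V i" for i x
    using that(2) by (rule convex_hull_halfspace_ge) (rule assms(3)[OF that(1)])
  show ge_sum: "sum b I \<le> c \<bullet> z" if "z \<in> (\<Sum>i\<in>I. convex hull V i)" for z
    using that unfolding Minkowski_sum_eq[OF assms(1)]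
    by (auto simp: inner_sum_right intro!: sum_mono ge)
  show eq: "(\<Sum>i\<in>I. convex hull V i) \<inter> {x. c \<bullet> x = sum b I} =
         (\<Sum>i\<in>I. convex hull {x \<in> V i. c \<bullet> x = b i})"
    by (subst Minkowski_sum_Int_supporting_hyperplane)
       (use assms ge in \<open>auto intro!: sum.cong convex_hull_Int_supporting_hyperplane\<close>)
  show "(\<Sum>i\<in>I. convex hull {x \<in> V i. c \<bullet> x = b i}) face_of (\<Sum>i\<in>I. convex hull V i)"
    unfolding eq[symmetric]
  proof (rule face_of_Int_supporting_hyperplane_ge)
    show "convex (\<Sum>i\<in>I. convex hull V i)" by (intro convex_set_sum) auto
  qed (rule ge_sum)
qed

text \<open>A sum of hulls is the hull of the sum, and a sum of finitely many finite sets is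
  finite.\<close>

lemma polytope_Minkowski_sum_convex_hull:
  fixes V :: "'i \<Rightarrow> 'a::euclidean_space set"
  assumes "finite I" and "\<And>i. i \<in> I \<Longrightarrow> finite (V i)"
  shows "polytope (\<Sum>i\<in>I. convex hull V i)"
  unfolding convex_hull_set_sum[symmetric] by (intro polytope_convex_hull finite_set_sum) (use assms in auto)

text \<open>Faces of polyhedra are exposed, so some functional has \<open>F\<close> as its set of
  minimisers on the sum. The sets \<open>A i\<close> consist of its minimisers on each
  \<open>V i\<close>.\<close>

lemma face_of_Minkowski_sum_convex_hull:
  fixes V :: "'i \<Rightarrow> 'a::euclidean_space set"
  assumes "finite I" and fin: "\<And>i. i \<in> I \<Longrightarrow> finite (V i)" and ne: "\<And>i. i \<in> I \<Longrightarrow> V i \<noteq> {}"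
    and F: "F face_of (\<Sum>i\<in>I. convex hull V i)" "F \<noteq> {}"
  obtains A where "\<And>i. i \<in> I \<Longrightarrow> A i \<subseteq> V i" "\<And>i. i \<in> I \<Longrightarrow> A i \<noteq> {}"
    "F = (\<Sum>i\<in>I. convex hull A i)"
proof -
  let ?P = "\<Sum>i\<in>I. convex hull V i"
  have "F exposed_face_of ?P"
    using F polytope_imp_polyhedron[OF polytope_Minkowski_sum_convex_hull[OF assms(1,2)]]
    by (simp add: exposed_face_of_polyhedron)
  then obtain a b where sub: "?P \<subseteq> {x. a \<bullet> x \<le> b}" and Feq: "F = ?P \<inter> {x. a \<bullet> x = b}"
    unfolding exposed_face_of_def by auto
  \<comment> \<open>Exposed faces come with an upper bound on \<open>a\<close>; negation turns it
    into the lower bounds used above.\<close>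
  define c where "c = - a"
  define m where "m i = Min ((\<bullet>) c ` V i)" for i
  have m: "m i \<le> c \<bullet> x" if "i \<in> I" "x \<in> V i" for i x
    unfolding m_def using that fin by simp
  have "\<exists>x\<in>V i. c \<bullet> x = m i" if "i \<in> I" for i
  proof -
    have "m i \<in> (\<bullet>) c ` V i"
      unfolding m_def using fin[OF that] ne[OF that] by (intro Min_in) auto
    then show ?thesis by auto
  qed
  then obtain y where y: "\<And>i. i \<in> I \<Longrightarrow> y i \<in> V i" "\<And>i. i \<in> I \<Longrightarrow> c \<bullet> y i = m i"
    by metis
  note exp = exposed_Minkowski_sum_convex_hull[where b = m, OF assms(1) fin m]
  \<comment> \<open>The minimum of \<open>c\<close> over the sum is computed twice: the point
    \<open>sum y I\<close> shows \<open>- b \<le> sum m I\<close>, and a point of \<open>F\<close>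
    shows the reverse.\<close>
  have "sum y I \<in> ?P"
    unfolding Minkowski_sum_eq[OF assms(1)] using y by (auto simp: hull_inc)
  then have "a \<bullet> sum y I \<le> b" using sub by blast
  moreover have "c \<bullet> sum y I = sum m I" by (simp add: inner_sum_right y)
  ultimately have "- b \<le> sum m I" by (simp add: c_def)
  moreover obtain z where "z \<in> ?P" "c \<bullet> z = - b"
    using Feq F(2) by (auto simp: c_def)
  moreover have "sum m I \<le> c \<bullet> z" if "z \<in> ?P" for z
    by (rule exp(1)) (use that in auto)
  ultimately have "sum m I = - b" by force
  then have "F = ?P \<inter> {x. c \<bullet> x = sum m I}"
    unfolding Feq by (auto simp: c_def)
  also have "\<dots> = (\<Sum>i\<in>I. convex hull {x \<in> V i. c \<bullet> x = m i})" by (rule exp(2))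
  finally show ?thesis
    by (rule that[rotated -1]) (use y in auto)
qed

section \<open>Dimension of a Minkowski sum of simplices\<close>

text \<open>The lower bound on the dimension comes from counting: one base point in each \<open>A i\<close> gives the
  differences \<open>W\<close>, and adding the \<open>card I - 1\<close> differences \<open>D\<close> of base points spans all
  differences of the affinely independent set \<open>\<Union>i\<in>I. A i\<close>.\<close>

lemma aff_dim_Minkowski_sum_convex_hull:
  fixes A :: "'i \<Rightarrow> 'a::euclidean_space set"
  assumes "finite I" "I \<noteq> {}" and ne: "\<And>i. i \<in> I \<Longrightarrow> A i \<noteq> {}"
    and disj: "disjoint_family_on A I" and indep: "\<not> affine_dependent (\<Union>i\<in>I. A i)"
  shows "aff_dim (\<Sum>i\<in>I. convex hull A i) = int (\<Sum>i\<in>I. card (A i)) - int (card I)"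
proof -
  let ?U = "\<Union>i\<in>I. A i" and ?F = "\<Sum>i\<in>I. convex hull A i"
  have finU: "finite ?U" by (rule aff_independent_finite[OF indep])
  then have fin: "finite (A i)" if "i \<in> I" for i
    using that by (meson UN_upper finite_subset)
  define b where "b i = (SOME x. x \<in> A i)" for i
  have b: "b i \<in> A i" if "i \<in> I" for i
    unfolding b_def using ne[OF that] by (simp add: some_in_eq)
  define W where "W = (\<Union>i\<in>I. (\<lambda>x. x - b i) ` (A i - {b i}))"
  obtain j where j: "j \<in> I" using assms(2) by auto
  define D where "D = (\<lambda>i. b i - b j) ` (I - {j})"
  define G where "G = (\<lambda>x. - sum b I + x) ` ?F"
  have F: "sum x I \<in> ?F" if "\<And>i. i \<in> I \<Longrightarrow> x i \<in> convex hull A i" for x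
    unfolding Minkowski_sum_eq[OF assms(1)] using that by auto
  have diff: "x - b i \<in> span W" if "i \<in> I" "x \<in> A i" for i x
    using that unfolding W_def by (cases "x = b i") (auto intro!: span_base simp: span_zero)
  have "W \<subseteq> G"
  proof
    fix w assume "w \<in> W"
    then obtain i x where i: "i \<in> I" "x \<in> A i" and w: "w = x - b i" unfolding W_def by auto
    have "sum (b(i := x)) I \<in> ?F"
      by (rule F) (use b i in \<open>auto simp: hull_inc\<close>)
    moreover have "sum (b(i := x)) I = sum b I + w"
      using i assms(1) by (simp add: sum.remove[of I i] w)
    ultimately show "w \<in> G" unfolding G_def by force
  qed
  moreover have "G \<subseteq> span W"
  proof
    fix g assume "g \<in> G"
    then obtain x where g: "g = sum x I - sum b I" and x: "\<And>i. i \<in> I \<Longrightarrow> x i \<in> convex hull A i"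
      unfolding G_def Minkowski_sum_eq[OF assms(1)] by auto
    have "x i - b i \<in> span W" if "i \<in> I" for i
    proof -
      have "convex hull A i \<subseteq> (\<lambda>v. b i + v) ` span W"
      proof (rule hull_minimal)
        show "A i \<subseteq> (\<lambda>v. b i + v) ` span W"
          using diff[OF that] by (force intro: image_eqI[where x = "_ - b i"])
        show "convex ((\<lambda>v. b i + v) ` span W)"
          by (intro convex_translation subspace_imp_convex subspace_span)
      qed
      with x[OF that] show ?thesis by auto
    qed
    then show "g \<in> span W"
      unfolding g sum_subtractf[symmetric] by (intro span_sum)
  qed
  ultimately have dimG: "dim G = dim W"
    by (intro antisym dim_mono dim_subset)
  \<comment> \<open>\<open>G\<close> is the sum translated so that the base point
    \<open>sum b I\<close> goes to the origin; there affine and linear dimension agree.\<close>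
  have "0 \<in> G" unfolding G_def using F[of b] b by (force simp: hull_inc)
  then have affF: "aff_dim ?F = int (dim W)"
    unfolding dimG[symmetric] by (metis G_def aff_dim_translation_eq aff_dim_zero hull_inc)
  have cardU: "card ?U = (\<Sum>i\<in>I. card (A i))"
    using assms(1) fin disj by (intro card_UN_disjoint) (auto simp: disjoint_family_on_def)
  have "card W \<le> (\<Sum>i\<in>I. card ((\<lambda>x. x - b i) ` (A i - {b i})))"
    unfolding W_def by (rule card_UN_le[OF assms(1)])
  also have "\<dots> \<le> (\<Sum>i\<in>I. card (A i) - 1)"
    by (intro sum_mono order_trans[OF card_image_le]) (use fin b in auto)
  \<comment> \<open>The truncated subtraction is exact because every \<open>A i\<close> is
    nonempty.\<close>
  also have "int \<dots> = int (\<Sum>i\<in>I. card (A i)) - int (card I)"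
  proof -
    have "1 \<le> card (A i)" if "i \<in> I" for i
      using fin[OF that] ne[OF that] by (simp add: Suc_leI card_gt_0_iff)
    then have "int (\<Sum>i\<in>I. card (A i) - 1) = (\<Sum>i\<in>I. int (card (A i)) - 1)"
      by (simp add: of_nat_diff)
    then show ?thesis by (simp add: sum_subtractf)
  qed
  finally have cardW: "int (card W) \<le> int (\<Sum>i\<in>I. card (A i)) - int (card I)" by simp
  have finW: "finite W" "finite D"
    unfolding W_def D_def using assms(1) fin by auto
  have "int (card ?U) - 1 = aff_dim ?U"
    using aff_dim_affine_independent[OF indep] by simp
  also have "\<dots> = int (dim ((\<lambda>x. - b j + x) ` ?U))"
  proof -
    have "b j \<in> ?U" using b[OF j] j by blast
    then show ?thesis
      using aff_dim_eq_dim[OF hull_inc, of "b j" ?U] by (simp cong: image_cong_simp)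
  qed
  also have "dim ((\<lambda>x. - b j + x) ` ?U) \<le> dim (W \<union> D)"
  proof (rule dim_mono, safe)
    fix i x assume i: "i \<in> I" "x \<in> A i"
    have "x - b i \<in> span (W \<union> D)"
      using diff[OF i] span_mono[of W "W \<union> D"] by auto
    moreover have "b i - b j \<in> span (W \<union> D)"
      using i by (cases "i = j") (auto simp: D_def span_zero intro: span_base)
    ultimately show "- b j + x \<in> span (W \<union> D)"
      using span_add[of "x - b i" "W \<union> D" "b i - b j"] by simp
  qed
  also have "dim (W \<union> D) \<le> dim W + card D"
  proof -
    obtain B where B: "B \<subseteq> W" "W \<subseteq> span B" "card B = dim W"
      using basis_exists[of W] by metis
    have "W \<union> D \<subseteq> span (B \<union> D)"
      using B span_mono[of B "B \<union> D"] span_superset[of "B \<union> D"] by auto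
    then have "dim (W \<union> D) \<le> card (B \<union> D)"
      using B finW by (intro dim_le_card) (auto intro: finite_subset)
    also have "\<dots> \<le> dim W + card D" using card_Un_le[of B D] B by simp
    finally show ?thesis .
  qed
  also have "card D \<le> card I - 1"
    unfolding D_def using card_image_le[of "I - {j}" "\<lambda>i. b i - b j"] assms(1) j by simp
  \<comment> \<open>The chain reads \<open>card ?U - 1 \<le> dim W + (card I - 1)\<close>; since
    \<open>j \<in> I\<close>, the two ones cancel.\<close>
  finally have "int (card ?U) - int (card I) \<le> int (dim W)"
    using j assms(1) card_gt_0_iff[of I] by force
  moreover have "dim W \<le> card W" by (rule dim_le_card') (rule finW)
  ultimately show ?thesis
    using cardW affF cardU by linarith
qed

section \<open>Families of nonempty subsets with a prescribed total size\<close>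

text \<open>Used to trim a family with too many points to one of exactly known size without emptying
  any member.\<close>

lemma ex_subfamily_sum_card:
  fixes A :: "'i \<Rightarrow> 'a set"
  assumes "finite I" and "\<And>i. i \<in> I \<Longrightarrow> finite (A i)" and "\<And>i. i \<in> I \<Longrightarrow> A i \<noteq> {}"
    and "card I \<le> r" and "r \<le> (\<Sum>i\<in>I. card (A i))"
  shows "\<exists>B. (\<forall>i\<in>I. B i \<subseteq> A i \<and> B i \<noteq> {}) \<and> (\<Sum>i\<in>I. card (B i)) = r"
  using assms
proof (induction I arbitrary: r rule: finite_induct)
  case empty
  then show ?case by auto
next
  case (insert j I)
  let ?s = "\<Sum>i\<in>I. card (A i)"
  have 1: "1 \<le> card (A j)"
    using insert.prems(1,2)[of j] by (simp add: Suc_leI card_gt_0_iff)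
  have "card I \<le> ?s"
  proof -
    have "1 \<le> card (A i)" if "i \<in> I" for i
      using insert.prems(1,2)[of i] that by (simp add: Suc_leI card_gt_0_iff)
    then have "(\<Sum>i\<in>I. 1) \<le> ?s" by (intro sum_mono)
    then show ?thesis by simp
  qed
  \<comment> \<open>As many points of \<open>A j\<close> as possible are kept while leaving one for
    each index in \<open>I\<close>.\<close>
  define q where "q = min (card (A j)) (r - card I)"
  have q: "1 \<le> q" "q \<le> card (A j)" "card I \<le> r - q" "r - q \<le> ?s" "q \<le> r"
    using insert 1 \<open>card I \<le> ?s\<close> unfolding q_def by auto
  obtain B where B: "\<forall>i\<in>I. B i \<subseteq> A i \<and> B i \<noteq> {}" "(\<Sum>i\<in>I. card (B i)) = r - q"
    using insert.IH[of "r - q"] insert.prems q by auto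
  obtain C where C: "C \<subseteq> A j" "card C = q"
    using obtain_subset_with_card_n[OF q(2)] by metis
  have "(\<Sum>i\<in>I. card ((B(j := C)) i)) = (\<Sum>i\<in>I. card (B i))"
    using insert.hyps by (intro sum.cong) auto
  then have "(\<Sum>i\<in>insert j I. card ((B(j := C)) i)) = r"
    using insert.hyps B q C by simp
  moreover have "C \<noteq> {}" using C q by auto
  ultimately show ?case
    using B C by (intro exI[of _ "B(j := C)"]) auto
qed

text \<open>The families are grouped by their size profile; those with profile \<open>s\<close> form
  a product of sets of \<open>s i\<close>-element subsets, which produces the binomial
  coefficients.\<close>

lemma card_PiE_subsets_sum_card:
  fixes V :: "'i \<Rightarrow> 'a set"
  assumes "finite I" and fin: "\<And>i. i \<in> I \<Longrightarrow> finite (V i)"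
  shows "card {A \<in> \<Pi>\<^sub>E i\<in>I. Pow (V i) - {{}}. (\<Sum>i\<in>I. card (A i)) = r} =
    (\<Sum>s | s \<in> (\<Pi>\<^sub>E i\<in>I. {1..card (V i)}) \<and> (\<Sum>i\<in>I. s i) = r. \<Prod>i\<in>I. card (V i) choose s i)"
    (is "card ?X = sum _ ?S")
proof -
  \<comment> \<open>The restriction to \<open>I\<close> makes the profile extensional, as the
    summation index \<open>s\<close> is.\<close>
  define g where "g A = (\<lambda>i\<in>I. card (A i))" for A :: "'i \<Rightarrow> 'a set"
  have finX: "finite ?X" and finS: "finite ?S"
    using assms by (simp_all add: finite_PiE)
  have "g ` ?X \<subseteq> ?S"
  proof (rule image_subsetI)
    fix A assume "A \<in> ?X"
    then have A: "A \<in> (\<Pi>\<^sub>E i\<in>I. Pow (V i) - {{}})" and r: "(\<Sum>i\<in>I. card (A i)) = r" by auto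
    have "card (A i) \<in> {1..card (V i)}" if "i \<in> I" for i
    proof -
      have "A i \<subseteq> V i" "A i \<noteq> {}" using PiE_mem[OF A that] by auto
      with fin[OF that] show ?thesis
        by (auto simp: Suc_le_eq card_gt_0_iff card_mono intro: finite_subset)
    qed
    then have "g A \<in> (\<Pi>\<^sub>E i\<in>I. {1..card (V i)})" by (auto simp: g_def)
    moreover have "sum (g A) I = r" using r by (simp add: g_def)
    ultimately show "g A \<in> ?S" by blast
  qed
  then have "card ?X = (\<Sum>s\<in>?S. card {A \<in> ?X. g A = s})"
    using sum.group[OF finX finS, of g "\<lambda>_. 1::nat"] by simp
  also have "\<dots> = (\<Sum>s\<in>?S. \<Prod>i\<in>I. card (V i) choose s i)"
  proof (rule sum.cong[OF refl])
    fix s assume s: "s \<in> ?S"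
    have "{A \<in> ?X. g A = s} = (\<Pi>\<^sub>E i\<in>I. {B. B \<subseteq> V i \<and> card B = s i})"
    proof (intro equalityI subsetI)
      fix A assume "A \<in> {A \<in> ?X. g A = s}"
      then show "A \<in> (\<Pi>\<^sub>E i\<in>I. {B. B \<subseteq> V i \<and> card B = s i})"
        by (auto simp: g_def PiE_iff)
    next
      fix A assume A: "A \<in> (\<Pi>\<^sub>E i\<in>I. {B. B \<subseteq> V i \<and> card B = s i})"
      have "g A = s"
        using A s by (intro PiE_ext[of "g A" I "\<lambda>_. UNIV" s]) (auto simp: g_def PiE_iff)
      moreover have "A i \<noteq> {}" if "i \<in> I" for i
        using A s that by (fastforce simp: PiE_iff)
      ultimately show "A \<in> {A \<in> ?X. g A = s}"
        using A s by (auto simp: PiE_iff)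
    qed
    then show "card {A \<in> ?X. g A = s} = (\<Prod>i\<in>I. card (V i) choose s i)"
      using assms by (simp add: card_PiE n_subsets)
  qed
  finally show ?thesis .
qed

section \<open>Counting the faces of a Minkowski sum\<close>

text \<open>The map \<open>f\<close> sending a family to the sum of its hulls is a bijection from
  \<open>?X\<close> onto the \<open>k\<close>-faces. Neighborliness makes \<open>f A\<close> a face
  and gives injectivity. Independence controls dimensions; the extra point in its bound
  \<open>k + card I + 1\<close> serves to exclude larger families in the proof of
  surjectivity.\<close>

lemma num_faces_Minkowski_sum_convex_hull:
  fixes V :: "'i \<Rightarrow> 'a::euclidean_space set"
  assumes I: "finite I" "I \<noteq> {}"
    and fin: "\<And>i. i \<in> I \<Longrightarrow> finite (V i)" and ne: "\<And>i. i \<in> I \<Longrightarrow> V i \<noteq> {}"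
    and disj: "disjoint_family_on V I"
    and indep: "\<And>S. S \<subseteq> (\<Union>i\<in>I. V i) \<Longrightarrow> card S \<le> k + card I + 1 \<Longrightarrow> \<not> affine_dependent S"
    and neighborly: "\<And>S. S \<subseteq> (\<Union>i\<in>I. V i) \<Longrightarrow> card S = k + card I \<Longrightarrow>
      \<exists>c b. \<forall>x\<in>\<Union>i\<in>I. V i. b \<le> c \<bullet> x \<and> (c \<bullet> x = b \<longleftrightarrow> x \<in> S)"
  shows "num_faces k (\<Sum>i\<in>I. convex hull V i) =
    card {A \<in> \<Pi>\<^sub>E i\<in>I. Pow (V i) - {{}}. (\<Sum>i\<in>I. card (A i)) = k + card I}" (is "_ = card ?X")
proof -
  define f where "f A = (\<Sum>i\<in>I. convex hull A i)" for A :: "'i \<Rightarrow> 'a set"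
  have card_Un: "card (\<Union>i\<in>I. A i) = (\<Sum>i\<in>I. card (A i))"
    if "\<And>i. i \<in> I \<Longrightarrow> A i \<subseteq> V i" for A
  proof (rule card_UN_disjoint[OF I(1)])
    show "\<forall>i\<in>I. finite (A i)" using that fin finite_subset by blast
    show "\<forall>i\<in>I. \<forall>j\<in>I. i \<noteq> j \<longrightarrow> A i \<inter> A j = {}"
      using that disj unfolding disjoint_family_on_def by blast
  qed
  have dim: "aff_dim (f A) = int (\<Sum>i\<in>I. card (A i)) - int (card I)"
    if "\<And>i. i \<in> I \<Longrightarrow> A i \<subseteq> V i" "\<And>i. i \<in> I \<Longrightarrow> A i \<noteq> {}" "(\<Sum>i\<in>I. card (A i)) \<le> k + card I + 1" for A
    unfolding f_def
  proof (rule aff_dim_Minkowski_sum_convex_hull[OF I])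
    show "disjoint_family_on A I"
      using disj that(1) unfolding disjoint_family_on_def by blast
    show "\<not> affine_dependent (\<Union>i\<in>I. A i)"
      by (rule indep) (use that card_Un[of A] in auto)
  qed (rule that)
  have X: "A i \<subseteq> V i" "A i \<noteq> {}" "(\<Sum>i\<in>I. card (A i)) = k + card I" if "A \<in> ?X" "i \<in> I" for A i
    using that by (auto simp: PiE_iff)
  \<comment> \<open>Disjointness of the \<open>V i\<close> lets one functional and one level
    \<open>b\<close>, chosen for the union, describe every \<open>A i\<close> separately.\<close>
  have exposed: "\<exists>c b. (\<forall>i\<in>I. \<forall>x\<in>V i. b \<le> c \<bullet> x \<and> (c \<bullet> x = b \<longleftrightarrow> x \<in> A i))" if A: "A \<in> ?X" for A
  proof -
    have "(\<Union>i\<in>I. A i) \<subseteq> (\<Union>i\<in>I. V i)" by (rule UN_mono[OF order_refl X(1)[OF A]])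
    moreover have "card (\<Union>i\<in>I. A i) = (\<Sum>i\<in>I. card (A i))"
      by (rule card_Un[OF X(1)[OF A]])
    then have "card (\<Union>i\<in>I. A i) = k + card I" using A by simp
    ultimately obtain c b where *: "\<forall>x\<in>\<Union>i\<in>I. V i. b \<le> c \<bullet> x \<and> (c \<bullet> x = b \<longleftrightarrow> x \<in> (\<Union>i\<in>I. A i))"
      by (elim neighborly[THEN exE] exE)
    have "x \<in> A i \<longleftrightarrow> x \<in> (\<Union>i\<in>I. A i)" if x: "i \<in> I" "x \<in> V i" for i x
    proof
      assume "x \<in> (\<Union>i\<in>I. A i)"
      then obtain j where j: "j \<in> I" "x \<in> A j" by blast
      then have "x \<in> V j" using X(1)[OF A] by blast
      then have "i = j" using disj x j(1) by (auto simp: disjoint_family_on_def)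
      then show "x \<in> A i" using j by simp
    qed (use x in blast)
    with * show ?thesis by (intro exI[of _ c] exI[of _ b]) simp
  qed
  have sub: "B i \<subseteq> A i" if A: "A \<in> ?X" and B: "B \<in> ?X" and eq: "f A = f B" and i: "i \<in> I" for A B i
  proof
    obtain c b where cb: "\<And>i x. i \<in> I \<Longrightarrow> x \<in> V i \<Longrightarrow> b \<le> c \<bullet> x"
      "\<And>i x. i \<in> I \<Longrightarrow> x \<in> V i \<Longrightarrow> c \<bullet> x = b \<longleftrightarrow> x \<in> A i"
      using exposed[OF A] by blast
    have Aeq: "{x \<in> V i. c \<bullet> x = b} = A i" if "i \<in> I" for i
      using cb(2)[OF that] X(1)[OF A that] by auto
    have fA: "f A = (\<Sum>i\<in>I. convex hull V i) \<inter> {x. c \<bullet> x = (\<Sum>i\<in>I. b)}"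
      using exposed_Minkowski_sum_convex_hull(2)[where b = "\<lambda>_. b", OF I(1) fin cb(1)]
      unfolding f_def by (simp add: Aeq)
    fix x assume x: "x \<in> B i"
    \<comment> \<open>Completing \<open>x\<close> by points of the other \<open>B j\<close> gives a
      point of \<open>f B = f A\<close>. The functional for \<open>A\<close> is minimal there, which
      forces each summand, in particular \<open>x\<close>, onto the level \<open>b\<close>.\<close>
    define y where "y i = (SOME x. x \<in> B i)" for i
    have y: "y i \<in> B i" if "i \<in> I" for i
      unfolding y_def using X(2)[OF B that] by (simp add: some_in_eq)
    let ?z = "y(i := x)"
    have z: "?z j \<in> B j" if "j \<in> I" for j using y x that by auto
    have "sum ?z I \<in> f B"
      unfolding f_def Minkowski_sum_eq[OF I(1)]
      by (rule CollectI, intro exI[of _ ?z] conjI ballI refl hull_inc z)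
    then have "c \<bullet> sum ?z I = (\<Sum>i\<in>I. b)"
      using eq fA by blast
    then have "(\<Sum>j\<in>I. c \<bullet> ?z j - b) = 0"
      by (simp add: inner_sum_right sum_subtractf del: fun_upd_apply)
    moreover have "0 \<le> c \<bullet> ?z j - b" if "j \<in> I" for j
      using cb(1)[OF that subsetD[OF X(1)[OF B that] z[OF that]]] by (simp del: fun_upd_apply)
    ultimately have "c \<bullet> ?z i - b = 0"
      using sum_nonneg_eq_0_iff[OF I(1), of "\<lambda>j. c \<bullet> ?z j - b"] i by (simp del: fun_upd_apply)
    then show "x \<in> A i" using cb(2)[OF i, of x] X(1)[OF B i] x by auto
  qed
  have "inj_on f ?X"
  proof (rule inj_onI)
    fix A B assume AB: "A \<in> ?X" "B \<in> ?X" "f A = f B"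
    show "A = B"
    proof (rule PiE_ext[of A I "\<lambda>i. Pow (V i) - {{}}" B])
      show "A i = B i" if "i \<in> I" for i
        using sub[OF AB that] sub[OF AB(2,1) AB(3)[symmetric] that] by blast
    qed (use AB in auto)
  qed
  then have "card (f ` ?X) = card ?X" by (rule card_image)
  moreover have "f ` ?X = {F. F face_of (\<Sum>i\<in>I. convex hull V i) \<and> aff_dim F = int k}"
  proof safe
    fix A assume "A \<in> (\<Pi>\<^sub>E i\<in>I. Pow (V i) - {{}})" "(\<Sum>i\<in>I. card (A i)) = k + card I"
    then have A: "A \<in> ?X" by auto
    obtain c b where cb: "\<And>i x. i \<in> I \<Longrightarrow> x \<in> V i \<Longrightarrow> b \<le> c \<bullet> x"
      "\<And>i x. i \<in> I \<Longrightarrow> x \<in> V i \<Longrightarrow> c \<bullet> x = b \<longleftrightarrow> x \<in> A i"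
      using exposed[OF A] by blast
    have Aeq: "{x \<in> V i. c \<bullet> x = b} = A i" if "i \<in> I" for i
      using cb(2)[OF that] X(1)[OF A that] by auto
    show "f A face_of (\<Sum>i\<in>I. convex hull V i)"
      using exposed_Minkowski_sum_convex_hull(3)[where b = "\<lambda>_. b", OF I(1) fin cb(1)]
      unfolding f_def by (simp add: Aeq)
    have "aff_dim (f A) = int (\<Sum>i\<in>I. card (A i)) - int (card I)"
      by (rule dim) (use X[OF A] A in auto)
    then show "aff_dim (f A) = int k" using A by (simp del: of_nat_sum)
  next
    fix F assume F: "F face_of (\<Sum>i\<in>I. convex hull V i)" "aff_dim F = int k"
    then have "F \<noteq> {}" by auto
    then obtain A where A: "\<And>i. i \<in> I \<Longrightarrow> A i \<subseteq> V i" "\<And>i. i \<in> I \<Longrightarrow> A i \<noteq> {}" "F = f A"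
      using face_of_Minkowski_sum_convex_hull[OF I(1) fin ne F(1)] unfolding f_def by metis
    have finA: "finite (A i)" if "i \<in> I" for i
      using A(1)[OF that] fin[OF that] by (rule finite_subset)
    \<comment> \<open>The formula \<open>dim\<close> covers at most \<open>k + card I + 1\<close>
      points, so a larger family is first trimmed to that size; its sum then has dimension
      \<open>k + 1\<close> inside the \<open>k\<close>-dimensional \<open>F\<close>.\<close>
    have "(\<Sum>i\<in>I. card (A i)) \<le> k + card I"
    proof (rule ccontr)
      assume "\<not> ?thesis"
      then have "k + card I + 1 \<le> (\<Sum>i\<in>I. card (A i))" by simp
      with I(1) finA A(2)
      have "\<exists>B. (\<forall>i\<in>I. B i \<subseteq> A i \<and> B i \<noteq> {}) \<and> (\<Sum>i\<in>I. card (B i)) = k + card I + 1"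
        by (intro ex_subfamily_sum_card) simp_all
      then obtain B where B: "\<And>i. i \<in> I \<Longrightarrow> B i \<subseteq> A i" "\<And>i. i \<in> I \<Longrightarrow> B i \<noteq> {}"
        "(\<Sum>i\<in>I. card (B i)) = k + card I + 1"
        by blast
      have "aff_dim (f B) = int (\<Sum>i\<in>I. card (B i)) - int (card I)"
        by (rule dim[OF subset_trans[OF B(1) A(1)] B(2)]) (simp_all add: B(3))
      moreover have "convex hull B i \<subseteq> convex hull A i" if "i \<in> I" for i
        using B(1)[OF that] by (rule hull_mono)
      then have "f B \<subseteq> f A"
        unfolding f_def Minkowski_sum_eq[OF I(1)] by blast
      ultimately show False
        using aff_dim_subset[of "f B" "f A"] F(2) A(3) B(3) by (simp del: of_nat_sum)
    qed
    moreover from this have "aff_dim (f A) = int (\<Sum>i\<in>I. card (A i)) - int (card I)"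
      by (intro dim A) simp_all
    ultimately have "(\<Sum>i\<in>I. card (A i)) = k + card I"
      using F(2) A(3) by (simp del: of_nat_sum)
    \<comment> \<open>Members of \<open>?X\<close> are extensional, whereas \<open>A\<close> is
      arbitrary outside \<open>I\<close>.\<close>
    then have "restrict A I \<in> ?X" using A by auto
    moreover have "F = f (restrict A I)"
      unfolding A(3) f_def by (intro sum.cong) auto
    ultimately show "F \<in> f ` ?X" by blast
  qed
  ultimately show ?thesis
    unfolding num_faces_def by simp
qed

text \<open>Converts the vertex counts in \<open>trivial_face_bound\<close> into cardinalities of
  generating sets: every point of an affinely independent set is extreme in its hull.\<close>

lemma num_faces_0_simplex:
  fixes S :: "'a::euclidean_space set"
  assumes "\<not> affine_dependent S"
  shows "num_faces 0 (convex hull S) = card S"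
proof -
  have "{F. F face_of convex hull S \<and> aff_dim F = int 0} = (\<lambda>x. {x}) ` S"
    using extreme_point_of_convex_hull_affine_independent[OF assms]
    by (auto simp: aff_dim_eq_0 face_of_singleton)
  then show ?thesis unfolding num_faces_def by (simp add: card_image)
qed

section \<open>The moment curve: independence and neighborliness\<close>

text \<open>The exponents \<open>e\<close> are meant to be a bijection from \<open>'d\<close> to \<open>{1..CARD('d)}\<close>.\<close>

definition moment_curve :: "('d::finite \<Rightarrow> nat) \<Rightarrow> real \<Rightarrow> real ^ 'd" where
  "moment_curve e t = (\<chi> j. t ^ e j)"

text \<open>Makes polynomials of degree at most the dimension available as affine functionals along
  the curve. The exponents start at 1, so the constant coefficient is split off.\<close>

lemma poly_eq_inner_moment_curve:
  fixes e :: "'d::finite \<Rightarrow> nat"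
  assumes e: "bij_betw e UNIV {1..CARD('d)}" and "degree p \<le> CARD('d)"
  shows "poly p t = coeff p 0 + (\<chi> j. coeff p (e j)) \<bullet> moment_curve e t"
proof -
  have "poly p t = (\<Sum>i\<le>CARD('d). coeff p i * t ^ i)"
    unfolding poly_altdef using assms(2)
    by (intro sum.mono_neutral_left) (auto simp: coeff_eq_0)
  also have "\<dots> = coeff p 0 + (\<Sum>i=1..CARD('d). coeff p i * t ^ i)"
  proof -
    have "{..CARD('d)} = insert 0 {1..CARD('d)}" by auto
    then show ?thesis by simp
  qed
  also have "(\<Sum>i=1..CARD('d). coeff p i * t ^ i) = (\<Sum>j\<in>UNIV. coeff p (e j) * t ^ e j)"
    by (rule sum.reindex_bij_betw[OF e, symmetric])
  finally show ?thesis by (simp add: inner_vec_def moment_curve_def)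
qed

text \<open>The coordinate with exponent 1 is the parameter itself.\<close>

lemma inj_moment_curve:
  fixes e :: "'d::finite \<Rightarrow> nat"
  assumes "bij_betw e UNIV {1..CARD('d)}"
  shows "inj (moment_curve e)"
proof (rule injI)
  fix s t assume *: "moment_curve e s = moment_curve e t"
  have "1 \<in> {1..CARD('d)}" using zero_less_card_finite by (simp add: Suc_le_eq)
  then obtain j where "e j = 1" using assms unfolding bij_betw_def by (metis imageE)
  with arg_cong[OF *, of "\<lambda>x. x $ j"] show "s = t" by (simp add: moment_curve_def)
qed

lemma degree_prod_linear: "degree (\<Prod>s\<in>S. [:- s, 1:]) \<le> card S" for S :: "real set"
  using degree_prod_sum_le[of S "\<lambda>s. [:- s, 1:]"]
  \<comment> \<open>For infinite \<open>S\<close> the product is 1 and the cardinality 0 by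
    convention.\<close>
  by (cases "finite S") auto

text \<open>An affine dependence annihilates every polynomial of degree at most the dimension.
  Applied to one vanishing on \<open>S\<close> except at \<open>t\<close>, it leaves only the term
  at \<open>t\<close>, whose coefficient is nonzero.\<close>

lemma affine_independent_moment_curve:
  fixes e :: "'d::finite \<Rightarrow> nat"
  assumes e: "bij_betw e UNIV {1..CARD('d)}" and "finite S" "card S \<le> CARD('d) + 1"
  shows "\<not> affine_dependent (moment_curve e ` S)"
proof
  let ?v = "moment_curve e"
  have inj: "inj_on ?v S" using inj_moment_curve[OF e] by (rule inj_on_subset) simp
  assume "affine_dependent (?v ` S)"
  then obtain u t where u: "sum u (?v ` S) = 0" "(\<Sum>x\<in>?v ` S. u x *\<^sub>R x) = 0"
    and t: "t \<in> S" "u (?v t) \<noteq> 0"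
    using assms(2) by (auto simp: affine_dependent_explicit_finite)
  define p where "p = (\<Prod>s\<in>S - {t}. [:- s, 1:])"
  have "degree p \<le> card (S - {t})" unfolding p_def by (rule degree_prod_linear)
  also have "\<dots> \<le> CARD('d)" using assms t by simp
  finally have poly: "poly p s = coeff p 0 + (\<chi> j. coeff p (e j)) \<bullet> ?v s" for s
    by (rule poly_eq_inner_moment_curve[OF e])
  have u': "(\<Sum>s\<in>S. u (?v s)) = 0" "(\<Sum>s\<in>S. u (?v s) *\<^sub>R ?v s) = 0"
    using u sum.reindex[OF inj, of u] sum.reindex[OF inj, of "\<lambda>x. u x *\<^sub>R x"] by simp_all
  have "(\<Sum>s\<in>S. u (?v s) * poly p s) =
    coeff p 0 * (\<Sum>s\<in>S. u (?v s)) + (\<chi> j. coeff p (e j)) \<bullet> (\<Sum>s\<in>S. u (?v s) *\<^sub>R ?v s)"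
    unfolding poly by (simp add: inner_sum_right sum_distrib_left sum.distrib algebra_simps)
  also have "\<dots> = 0" using u' by simp
  also have "(\<Sum>s\<in>S. u (?v s) * poly p s) = u (?v t) * poly p t"
    using assms(2) t(1)
    by (subst sum.remove[of S t]) (auto simp: p_def poly_prod intro!: sum.neutral)
  finally have "poly p t = 0" using t by simp
  then show False using assms(2) by (auto simp: p_def poly_prod)
qed

text \<open>The square \<open>q ^ 2\<close> is nonnegative, vanishes exactly on \<open>S\<close> and
  has degree at most \<open>2 * card S\<close>. Moving its constant coefficient to the other side
  gives the level \<open>b\<close>.\<close>

lemma moment_curve_neighborly:
  fixes e :: "'d::finite \<Rightarrow> nat"
  assumes e: "bij_betw e UNIV {1..CARD('d)}" and "finite S" "2 * card S \<le> CARD('d)"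
  shows "\<exists>c b. \<forall>t. b \<le> c \<bullet> moment_curve e t \<and> (c \<bullet> moment_curve e t = b \<longleftrightarrow> t \<in> S)"
proof -
  define q where "q = (\<Prod>s\<in>S. [:- s, 1:])"
  have "degree (q ^ 2) \<le> CARD('d)"
    using degree_power_le[of q 2] degree_prod_linear[of S] assms(3) by (simp add: q_def)
  from poly_eq_inner_moment_curve[OF e this]
  have "(\<chi> j. coeff (q ^ 2) (e j)) \<bullet> moment_curve e t = (poly q t)\<^sup>2 - coeff (q ^ 2) 0" for t
    by simp
  moreover have "poly q t = 0 \<longleftrightarrow> t \<in> S" for t
    using assms(2) by (auto simp: q_def poly_prod)
  ultimately show ?thesis
    by (intro exI[of _ "\<chi> j. coeff (q ^ 2) (e j)"] exI[of _ "- coeff (q ^ 2) 0"]) auto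
qed

section \<open>The simplices on the moment curve\<close>

theorem theorem4:
  fixes n :: nat
  assumes "CARD('d::finite) \<ge> 4"
    and "1 \<le> n" and "n \<le> CARD('d) div 2"
  shows "\<exists>P :: nat \<Rightarrow> (real ^ 'd) set.
           (\<forall>i\<in>{1..n}. polytope (P i) \<and> aff_dim (P i) = int CARD('d)) \<and>
           (\<forall>k \<le> CARD('d) div 2 - n.
              num_faces k (\<Sum>i=1..n. P i) = trivial_face_bound n k P)"
proof -
  obtain e :: "'d \<Rightarrow> nat" where e: "bij_betw e UNIV {1..CARD('d)}"
    using finite_same_card_bij[of "UNIV :: 'd set" "{1..CARD('d)}"] by auto
  let ?v = "moment_curve e" and ?m = "CARD('d) + 1"
  \<comment> \<open>Consecutive blocks of \<open>?m\<close> integers serve as parameters; division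
    by \<open>?m\<close> recovers the block, hence disjointness.\<close>
  define T :: "nat \<Rightarrow> real set" where "T i = real ` {i * ?m..<Suc i * ?m}" for i
  define V where "V i = ?v ` T i" for i
  have finT: "finite (T i)" for i by (simp add: T_def)
  have cardT: "card (T i) = ?m" for i by (simp add: T_def card_image)
  have finV: "finite (V i)" for i by (simp add: V_def finT)
  have cardV: "card (V i) = ?m" for i
    unfolding V_def using inj_moment_curve[OF e] cardT by (metis card_image inj_on_subset subset_UNIV)
  have neV: "V i \<noteq> {}" for i using cardV[of i] by auto
  have indepV: "\<not> affine_dependent (V i)" for i
    unfolding V_def by (rule affine_independent_moment_curve[OF e]) (simp_all add: finT cardT)
  have "i = j" if t: "t \<in> T i" "t \<in> T j" for i j t
  proof -
    have div: "x div ?m = i" if "x \<in> {i * ?m..<Suc i * ?m}" for x i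
      using that by (intro div_nat_eqI) (auto simp: mult.commute)
    obtain x where x: "x \<in> {i * ?m..<Suc i * ?m}" "t = real x"
      using t(1) unfolding T_def by (elim imageE)
    obtain y where y: "y \<in> {j * ?m..<Suc j * ?m}" "t = real y"
      using t(2) unfolding T_def by (elim imageE)
    have "x = y" using x(2) y(2) by simp
    with div[OF x(1)] div[OF y(1)] show ?thesis by (simp only:)
  qed
  then have disj: "disjoint_family_on V {1..n}"
    unfolding disjoint_family_on_def V_def using inj_moment_curve[OF e] by (auto dest: injD)
  \<comment> \<open>Vertex sets are pulled back to parameter sets of equal size, since the lemmas on
    the curve speak of parameters.\<close>
  have curve: "\<exists>S'. finite S' \<and> card S' = card S \<and> S = ?v ` S'" if "S \<subseteq> (\<Union>i\<in>{1..n}. V i)" for S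
  proof -
    have "finite S" using that finV by (meson finite_UN_I finite_atLeastAtMost finite_subset)
    moreover have "S \<subseteq> range ?v" using that by (auto simp: V_def)
    moreover have "inj_on ?v S'" for S'
      using inj_moment_curve[OF e] by (rule inj_on_subset) simp
    ultimately show ?thesis by (metis card_image finite_imageD subset_imageE)
  qed
  have "num_faces k (\<Sum>i=1..n. convex hull V i) = trivial_face_bound n k (\<lambda>i. convex hull V i)"
    if k: "k \<le> CARD('d) div 2 - n" for k
  proof -
    have "num_faces k (\<Sum>i=1..n. convex hull V i) =
      card {A \<in> \<Pi>\<^sub>E i\<in>{1..n}. Pow (V i) - {{}}. (\<Sum>i=1..n. card (A i)) = k + card {1..n}}"
    proof (rule num_faces_Minkowski_sum_convex_hull)
      fix S assume S: "S \<subseteq> (\<Union>i\<in>{1..n}. V i)"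
      obtain S' where S': "finite S'" "card S' = card S" "S = ?v ` S'"
        using curve[OF S] by auto
      show "\<not> affine_dependent S" if "card S \<le> k + card {1..n} + 1"
        unfolding S'(3) by (rule affine_independent_moment_curve[OF e S'(1)]) (use that S'(2) k assms in auto)
      assume "card S = k + card {1..n}"
      \<comment> \<open>Since \<open>n \<le> CARD('d) div 2\<close>, the bound on \<open>k\<close>
        means \<open>k + n \<le> CARD('d) div 2\<close>, exactly the range in which a square of
        degree at most \<open>CARD('d)\<close> exists.\<close>
      then have "2 * card S' \<le> CARD('d)" using S'(2) k assms by auto
      from moment_curve_neighborly[OF e S'(1) this] obtain c b
        where cb: "\<forall>t. b \<le> c \<bullet> ?v t \<and> (c \<bullet> ?v t = b \<longleftrightarrow> t \<in> S')" by blast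
      have "?v t \<in> S \<longleftrightarrow> t \<in> S'" for t
        unfolding S'(3) using inj_moment_curve[OF e] by (simp add: inj_image_mem_iff)
      with cb show "\<exists>c b. \<forall>x\<in>\<Union>i\<in>{1..n}. V i. b \<le> c \<bullet> x \<and> (c \<bullet> x = b \<longleftrightarrow> x \<in> S)"
        by (intro exI[of _ c] exI[of _ b]) (auto simp: V_def)
    qed (use assms finV neV disj in auto)
    also have "\<dots> = trivial_face_bound n k (\<lambda>i. convex hull V i)"
      unfolding trivial_face_bound_def
      by (subst card_PiE_subsets_sum_card) (simp_all add: finV num_faces_0_simplex[OF indepV])
    finally show ?thesis .
  qed
  moreover have "polytope (convex hull V i)" "aff_dim (convex hull V i) = int CARD('d)" for i
    using aff_dim_affine_independent[OF indepV[of i]] finV[of i] cardV[of i]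
    by (simp_all add: polytope_convex_hull aff_dim_convex_hull)
  ultimately show ?thesis
    by (intro exI[of _ "\<lambda>i. convex hull V i"]) blast
qed

end
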